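(* Let $X$ be a closed set of (finite) permutations. The following conditions are equivalent: (1) $X=\mathrm{Sub}(\pi:A\rightarrow B)$ for some sets $A,B\subseteq\mathbb{R}$ and some bijection $\pi:A\to B$; (2) $X$ cannot be expressed as a union of two proper closed subsets; (3) for every $\alpha,\beta\in X$ there exists $\gamma\in X$ such that $\alpha\preceq\gamma$ and $\beta\preceq\gamma$; (4) $X$ contains permutations $\gamma_1\preceq\gamma_2\preceq\cdots$ such that for every $\alpha\in X$ we have $\alpha\preceq\gamma_n$ for some $n$.
   Context: A permutation of length $n$ is an arrangement of $1,2,\ldots,n$. Two finite sequences of distinct reals $a_1\cdots a_n$ and $b_1\cdots b_n$ are order isomorphic if for all $i,j$, $a_i<a_j$ iff $b_i<b_j$. A permutation $\alpha$ is involved in a sequence $\beta$, written $\alpha\preceq\beta$, if $\alpha$ is order isomorphic to a subsequence of $\beta$. A closed set is a set $X$ of permutations such that $\alpha\in X$ and $\delta\preceq\alpha$ imply $\delta\in X$. For sets $A,B\subseteq\mathbb{R}$ and a bijection $\pi:A\to B$, $\mathrm{Sub}(\pi:A\rightarrow B)$ is the set of all permutations order isomorphic to some sequence $\pi(c_1)\pi(c_2)\cdots\pi(c_n)$ with $c_1<c_2<\cdots<c_n$ in $A$ (finite).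
   Formalization: The closed set X is assumed nonempty (the empty permutation counts as a permutation): for X empty, conditions (2) and (3) hold vacuously while (4), which asks X to contain a chain of permutations, fails. *)

theory Defs
  imports Complex_Main "HOL-Library.Sublist"
begin

text \<open>A permutation is represented as the list of its values in one-line notation.
  The empty permutation (of length 0) is included.\<close>

definition permutations :: "nat list set" where
  "permutations = {xs. distinct xs \<and> set xs = {1..length xs}}"

text \<open>Only meant for lists without repetitions.\<close>

definition order_iso :: "'a::linorder list \<Rightarrow> 'b::linorder list \<Rightarrow> bool" where
  "order_iso as bs \<longleftrightarrow> length as = length bs \<and>
     (\<forall>i<length as. \<forall>j<length as. as ! i < as ! j \<longleftrightarrow> bs ! i < bs ! j)"

definition involved :: "'a::linorder list \<Rightarrow> 'b::linorder list \<Rightarrow> bool"  (infix "\<preceq>" 50) where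
  "as \<preceq> bs \<longleftrightarrow> (\<exists>cs. subseq cs bs \<and> order_iso as cs)"

definition closed_class :: "nat list set \<Rightarrow> bool" where
  "closed_class X \<longleftrightarrow> X \<subseteq> permutations \<and>
     (\<forall>\<alpha>\<in>X. \<forall>\<delta>\<in>permutations. \<delta> \<preceq> \<alpha> \<longrightarrow> \<delta> \<in> X)"

text \<open>The codomain of \<open>\<pi>\<close> does not influence the set, so it is not a parameter; bijectivity onto
  it is required where \<open>Sub\<close> is used.\<close>

definition Sub :: "(real \<Rightarrow> real) \<Rightarrow> real set \<Rightarrow> nat list set" where
  "Sub \<pi> A = {\<alpha> \<in> permutations.
     \<exists>cs. sorted_wrt (<) cs \<and> set cs \<subseteq> A \<and> order_iso \<alpha> (map \<pi> cs)}"

end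

theory Submission
  imports Defs "HOL-Library.Countable_Set"
begin

text \<open>The substance is that (4) implies (1). Fixing embeddings along the chain, all entries of all its
  members form a countable set that carries two linear preorders, by position and by value, with the
  same induced equivalence: two entries are compared in any member of the chain late enough to contain
  both. Each preorder embeds in the reals through \<open>p \<mapsto> \<Sum>{2\<^sup>-\<^sup>k | the k-th element lies below p}\<close>,
  and \<open>\<pi>\<close> sends the position coordinate of an entry to its value coordinate. For (2) implies (3),
  if \<open>\<alpha>\<close> and \<open>\<beta>\<close> have no common upper bound, then \<open>X\<close> is the union of its members avoiding \<open>\<alpha>\<close> and
  those avoiding \<open>\<beta>\<close>.\<close>

section \<open>Involvement in terms of positions\<close>

text \<open>Skipping an entry of \<open>ys\<close> shifts the index map by one; matching the heads
  sends 0 to 0 and shifts the rest.\<close>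

lemma subseq_imp_index_map:
  assumes "subseq xs ys"
  shows "\<exists>h. strict_mono_on {..<length xs} h \<and> (\<forall>i<length xs. h i < length ys \<and> ys ! h i = xs ! i)"
  using assms
proof (induction rule: list_emb.induct)
  case (list_emb_Nil ys)
  then show ?case by (auto simp: strict_mono_on_def)
next
  case (list_emb_Cons xs ys y)
  then obtain h where h: "strict_mono_on {..<length xs} h"
    "\<forall>i<length xs. h i < length ys \<and> ys ! h i = xs ! i" by blast
  show ?case
    by (rule exI[of _ "Suc \<circ> h"]) (use h in \<open>auto simp: strict_mono_on_def\<close>)
next
  case (list_emb_Cons2 x y xs ys)
  then obtain h where h: "strict_mono_on {..<length xs} h"
    "\<forall>i<length xs. h i < length ys \<and> ys ! h i = xs ! i" by blast
  show ?case
    by (rule exI[of _ "case_nat 0 (Suc \<circ> h)"])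
      (use h list_emb_Cons2.hyps in \<open>auto simp: strict_mono_on_def nth_Cons split: nat.splits\<close>)
qed

text \<open>The variable cut \<open>k\<close> drives the induction: all indices before the last lie
  below \<open>h n\<close>, so the hypothesis applies with cut \<open>h n\<close>, and the entry at
  \<open>h n\<close> is appended.\<close>

lemma subseq_map_nth_take:
  assumes "strict_mono_on {..<n} h" "\<forall>i<n. h i < k" "k \<le> length ys"
  shows "subseq (map (\<lambda>i. ys ! h i) [0..<n]) (take k ys)"
  using assms
proof (induction n arbitrary: k)
  case 0
  then show ?case by simp
next
  case (Suc n)
  have "h n < k" "h n < length ys" using Suc.prems by auto
  then have "subseq (map (\<lambda>i. ys ! h i) [0..<n]) (take (h n) ys)"
    using Suc.prems by (intro Suc.IH) (auto simp: strict_mono_on_def)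
  then have "subseq (map (\<lambda>i. ys ! h i) [0..<Suc n]) (take (Suc (h n)) ys)"
    using \<open>h n < length ys\<close> by (simp add: take_Suc_conv_app_nth)
  moreover have "prefix (take (Suc (h n)) ys) (take k ys)"
    using \<open>h n < k\<close> by (metis Suc_leI min.absorb1 take_is_prefix take_take)
  ultimately show ?case
    by (meson prefix_imp_subseq subseq_order.order_trans)
qed

text \<open>Working form of involvement: embeddings become maps of indices, which compose and can be
  followed along a chain.\<close>

lemma involved_iff_index_map:
  "as \<preceq> bs \<longleftrightarrow> (\<exists>h. strict_mono_on {..<length as} h \<and> (\<forall>i<length as. h i < length bs) \<and>
     (\<forall>i<length as. \<forall>j<length as. as ! i < as ! j \<longleftrightarrow> bs ! h i < bs ! h j))"
  (is "?L \<longleftrightarrow> ?R")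
proof
  assume ?L
  then obtain cs where "subseq cs bs" and iso: "order_iso as cs"
    unfolding involved_def by blast
  then obtain h where "strict_mono_on {..<length cs} h"
    "\<forall>i<length cs. h i < length bs \<and> bs ! h i = cs ! i"
    using subseq_imp_index_map by blast
  then show ?R using iso unfolding order_iso_def by (intro exI[of _ h]) auto
next
  assume ?R
  then obtain h where h: "strict_mono_on {..<length as} h" "\<forall>i<length as. h i < length bs"
    "\<forall>i<length as. \<forall>j<length as. as ! i < as ! j \<longleftrightarrow> bs ! h i < bs ! h j" by blast
  have "subseq (map (\<lambda>i. bs ! h i) [0..<length as]) bs"
    using subseq_map_nth_take[OF h(1,2), of bs] by simp
  moreover have "order_iso as (map (\<lambda>i. bs ! h i) [0..<length as])"
    using h(3) by (simp add: order_iso_def)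
  ultimately show ?L unfolding involved_def by blast
qed

lemma involved_refl: "as \<preceq> as"
  unfolding involved_def order_iso_def by (intro exI[of _ as]) simp

lemma involved_trans:
  assumes "as \<preceq> bs" "bs \<preceq> cs"
  shows "as \<preceq> cs"
proof -
  obtain h where h: "strict_mono_on {..<length as} h" "\<forall>i<length as. h i < length bs"
    "\<forall>i<length as. \<forall>j<length as. as ! i < as ! j \<longleftrightarrow> bs ! h i < bs ! h j"
    using assms(1) unfolding involved_iff_index_map by blast
  obtain g where g: "strict_mono_on {..<length bs} g" "\<forall>i<length bs. g i < length cs"
    "\<forall>i<length bs. \<forall>j<length bs. bs ! i < bs ! j \<longleftrightarrow> cs ! g i < cs ! g j"
    using assms(2) unfolding involved_iff_index_map by blast
  have "strict_mono_on {..<length as} (g \<circ> h)"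
    using h(1,2) g(1) by (simp add: strict_mono_on_def)
  then show ?thesis
    unfolding involved_iff_index_map using h(2,3) g(2,3) by (intro exI[of _ "g \<circ> h"]) simp
qed

lemma mem_Sub_iff_index_map:
  "\<alpha> \<in> Sub \<pi> A \<longleftrightarrow> \<alpha> \<in> permutations \<and>
     (\<exists>c. strict_mono_on {..<length \<alpha>} c \<and> (\<forall>i<length \<alpha>. c i \<in> A) \<and>
       (\<forall>i<length \<alpha>. \<forall>j<length \<alpha>. \<alpha> ! i < \<alpha> ! j \<longleftrightarrow> \<pi> (c i) < \<pi> (c j)))"
  (is "_ \<longleftrightarrow> _ \<and> ?R")
proof -
  have "(\<exists>cs. sorted_wrt (<) cs \<and> set cs \<subseteq> A \<and> order_iso \<alpha> (map \<pi> cs)) \<longleftrightarrow> ?R" (is "?L \<longleftrightarrow> _")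
  proof
    assume ?L
    then obtain cs where "sorted_wrt (<) cs" "set cs \<subseteq> A" "order_iso \<alpha> (map \<pi> cs)" by blast
    then show ?R
      by (intro exI[of _ "(!) cs"])
        (auto simp: order_iso_def strict_mono_on_def sorted_wrt_iff_nth_less)
  next
    assume ?R
    then obtain c where "strict_mono_on {..<length \<alpha>} c" "\<forall>i<length \<alpha>. c i \<in> A"
      "\<forall>i<length \<alpha>. \<forall>j<length \<alpha>. \<alpha> ! i < \<alpha> ! j \<longleftrightarrow> \<pi> (c i) < \<pi> (c j)" by blast
    then show ?L
      by (intro exI[of _ "map c [0..<length \<alpha>]"])
        (auto simp: order_iso_def strict_mono_on_def sorted_wrt_iff_nth_less)
  qed
  then show ?thesis by (simp add: Sub_def)
qed

section \<open>Joint embedding in \<open>Sub\<close>\<close>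

text \<open>Counting with \<open>\<le>\<close> starts the ranks of the elements of a finite
  \<open>S\<close> at 1, as \<open>permutations\<close> requires.\<close>

definition rank :: "'a::linorder set \<Rightarrow> 'a \<Rightarrow> nat" where
  "rank S y = card {z \<in> S. z \<le> y}"

lemma rank_less_iff:
  assumes "finite S" "x \<in> S" "y \<in> S"
  shows "rank S x < rank S y \<longleftrightarrow> x < y"
proof -
  have *: "rank S a < rank S b" if "a < b" "b \<in> S" for a b
    unfolding rank_def
  proof (rule psubset_card_mono)
    have "b \<in> {z \<in> S. z \<le> b} - {z \<in> S. z \<le> a}" using that by auto
    then show "{z \<in> S. z \<le> a} \<subset> {z \<in> S. z \<le> b}" using that by auto
  qed (use assms(1) in simp)
  show ?thesis using *[of x y] *[of y x] assms by (metis less_asym linorder_neqE less_irrefl)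
qed

text \<open>Standardization: ranks are injective on the entries and lie in
  \<open>{1..length ys}\<close>, so by cardinality they fill it.\<close>

lemma map_rank_permutation:
  assumes "distinct ys"
  shows "map (rank (set ys)) ys \<in> permutations"
proof -
  have inj: "inj_on (rank (set ys)) (set ys)"
    by (rule inj_onI) (metis List.finite_set rank_less_iff less_irrefl linorder_neqE)
  have "rank (set ys) ` set ys \<subseteq> {1..length ys}"
  proof
    fix r assume "r \<in> rank (set ys) ` set ys"
    then obtain y where y: "y \<in> set ys" "r = card {z \<in> set ys. z \<le> y}" by (auto simp: rank_def)
    have "{z \<in> set ys. z \<le> y} \<noteq> {}" using y by auto
    then have "r \<ge> 1" using y by (simp add: Suc_le_eq card_gt_0_iff)
    moreover have "r \<le> card (set ys)" unfolding y by (intro card_mono) auto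
    ultimately show "r \<in> {1..length ys}" using assms by (simp add: distinct_card)
  qed
  then have "rank (set ys) ` set ys = {1..length ys}"
    using inj assms by (intro card_subset_eq) (auto simp: card_image distinct_card)
  then show ?thesis using assms inj by (simp add: permutations_def distinct_map)
qed

text \<open>Pooling the points sampled for \<alpha> and \<beta> gives one common sample; by
  injectivity its values are distinct, so their ranks form a permutation containing both
  patterns.\<close>

lemma Sub_joint_embedding:
  assumes "inj_on \<pi> A" "\<alpha> \<in> Sub \<pi> A" "\<beta> \<in> Sub \<pi> A"
  shows "\<exists>\<gamma>\<in>Sub \<pi> A. \<alpha> \<preceq> \<gamma> \<and> \<beta> \<preceq> \<gamma>"
proof -
  obtain as where as: "sorted_wrt (<) as" "set as \<subseteq> A" "order_iso \<alpha> (map \<pi> as)"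
    using assms(2) by (auto simp: Sub_def)
  obtain bs where bs: "sorted_wrt (<) bs" "set bs \<subseteq> A" "order_iso \<beta> (map \<pi> bs)"
    using assms(3) by (auto simp: Sub_def)
  define es where "es = sorted_list_of_set (set as \<union> set bs)"
  have es: "sorted_wrt (<) es" "set es = set as \<union> set bs" "distinct es"
    by (simp_all add: es_def)
  define \<gamma> where "\<gamma> = map (rank (\<pi> ` set es)) (map \<pi> es)"
  have inj: "inj_on \<pi> (set es)" using assms(1) as(2) bs(2) es(2) by (metis inj_on_subset le_sup_iff)
  have "\<gamma> \<in> permutations"
    using map_rank_permutation[of "map \<pi> es"] es(3) inj by (simp add: \<gamma>_def distinct_map)
  moreover have "order_iso \<gamma> (map \<pi> es)"
    by (auto simp: \<gamma>_def order_iso_def rank_less_iff)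
  ultimately have "\<gamma> \<in> Sub \<pi> A" using es as(2) bs(2) by (auto simp: Sub_def)
  moreover have "\<delta> \<preceq> \<gamma>" if cs: "sorted_wrt (<) cs" "set cs \<subseteq> set es" "order_iso \<delta> (map \<pi> cs)" for \<delta> :: "nat list" and cs
  proof -
    \<comment> \<open>Both lists are strictly increasing, so inclusion of their sets already gives a
      subsequence.\<close>
    have "subseq cs es"
      using cs(1,2) by (intro sorted_subset_imp_subseq) (auto simp: es_def)
    then have "subseq (map (rank (\<pi> ` set es)) (map \<pi> cs)) \<gamma>"
      unfolding \<gamma>_def by (intro subseq_map)
    moreover have "order_iso \<delta> (map (rank (\<pi> ` set es)) (map \<pi> cs))"
    proof -
      have "cs ! i \<in> set es" if "i < length cs" for i using cs(2) that by auto
      then show ?thesis using cs(3) by (simp add: order_iso_def rank_less_iff)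
    qed
    ultimately show ?thesis unfolding involved_def by blast
  qed
  ultimately show ?thesis using as bs es(2) by blast
qed

section \<open>Countable linear preorders embed in the reals\<close>

text \<open>Elements equivalent under \<open>L\<close> have the same lower set and get the same
  real, so one point of a limit may carry several names.\<close>

lemma countable_linear_preorder_real_embedding:
  fixes D :: "'a::countable set" and L :: "'a \<Rightarrow> 'a \<Rightarrow> bool"
  assumes total: "\<And>p q. p \<in> D \<Longrightarrow> q \<in> D \<Longrightarrow> L p q \<or> L q p"
    and trans: "\<And>p q r. p \<in> D \<Longrightarrow> q \<in> D \<Longrightarrow> r \<in> D \<Longrightarrow> L p q \<Longrightarrow> L q r \<Longrightarrow> L p r"
  obtains f :: "'a \<Rightarrow> real" where "\<And>p q. p \<in> D \<Longrightarrow> q \<in> D \<Longrightarrow> f p \<le> f q \<longleftrightarrow> L p q"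
proof -
  define S where "S p = to_nat ` {q \<in> D. L q p}" for p
  \<comment> \<open>Geometric weights make all sums converge; each weight is positive, so a strictly
    larger set has a strictly larger sum.\<close>
  define w :: "nat set \<Rightarrow> nat \<Rightarrow> real" where "w T k = (if k \<in> T then (1/2) ^ k else 0)" for T k
  have summable: "summable (w T)" for T
    by (rule summable_comparison_test'[of "\<lambda>k. (1/2) ^ k" 0]) (auto simp: w_def)
  have mono: "suminf (w T) \<le> suminf (w U)" if "T \<subseteq> U" for T U
    using that by (intro suminf_le summable) (auto simp: w_def)
  have strict: "suminf (w T) < suminf (w U)" if "T \<subseteq> U" "k \<in> U" "k \<notin> T" for T U k
  proof -
    have "0 < (\<Sum>k. w U k - w T k)"
      using that by (intro suminf_pos2[of _ k] summable_diff summable) (auto simp: w_def)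
    then show ?thesis by (simp flip: suminf_diff[OF summable summable])
  qed
  show thesis
  proof (rule that[of "\<lambda>p. suminf (w (S p))"])
    fix p q assume pq: "p \<in> D" "q \<in> D"
    show "suminf (w (S p)) \<le> suminf (w (S q)) \<longleftrightarrow> L p q"
    proof (cases "L p q")
      case True
      then have "S p \<subseteq> S q" unfolding S_def using trans pq by blast
      then show ?thesis using True mono by blast
    next
      case False
      \<comment> \<open>By totality \<open>q\<close> lies below \<open>p\<close>; moreover
        \<open>p\<close> belongs to its own lower set but not to that of \<open>q\<close>, so the
        sum for \<open>p\<close> is strictly larger.\<close>
      then have "L q p" "L p p" using total pq by blast+
      have "S q \<subseteq> S p" unfolding S_def using trans[OF _ pq(2,1) _ \<open>L q p\<close>] by blast
      moreover have "to_nat p \<in> S p" unfolding S_def using pq \<open>L p p\<close> by blast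
      moreover have "to_nat p \<notin> S q" unfolding S_def using False by auto
      ultimately show ?thesis using False strict by (simp add: not_le)
    qed
  qed
qed

section \<open>The limit of an ascending chain\<close>

text \<open>Follows the entry at position \<open>snd p\<close> of the \<open>fst p\<close>-th member of the chain through the
  embeddings \<open>e\<close> into the \<open>N\<close>-th member. Junk for \<open>N < fst p\<close>.\<close>

primrec pos :: "(nat \<Rightarrow> nat \<Rightarrow> nat) \<Rightarrow> nat \<Rightarrow> nat \<times> nat \<Rightarrow> nat" where
  "pos e 0 p = snd p"
| "pos e (Suc N) p = (if N < fst p then snd p else e N (pos e N p))"

lemma pos_fst: "pos e (fst p) p = snd p"
  by (cases "fst p") auto

lemma chain_limit:
  fixes \<gamma> :: "nat \<Rightarrow> 'a::linorder list"
  assumes chain: "\<And>n. \<gamma> n \<preceq> \<gamma> (Suc n)" and dist: "\<And>n. distinct (\<gamma> n)"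
  obtains A \<pi> where "inj_on \<pi> A" "Sub \<pi> A = {\<alpha> \<in> permutations. \<exists>n. \<alpha> \<preceq> \<gamma> n}"
proof -
  obtain e where e: "\<And>n. strict_mono_on {..<length (\<gamma> n)} (e n)"
    "\<And>n i. i < length (\<gamma> n) \<Longrightarrow> e n i < length (\<gamma> (Suc n))"
    "\<And>n i j. i < length (\<gamma> n) \<Longrightarrow> j < length (\<gamma> n) \<Longrightarrow>
       \<gamma> (Suc n) ! e n i < \<gamma> (Suc n) ! e n j \<longleftrightarrow> \<gamma> n ! i < \<gamma> n ! j"
    using chain unfolding involved_iff_index_map by metis
  have e_less: "e n i < e n j \<longleftrightarrow> i < j" if "i < length (\<gamma> n)" "j < length (\<gamma> n)" for n i j
    using e(1)[of n] that by (metis strict_mono_on_less lessThan_iff)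
  \<comment> \<open>A pair \<open>(n, i)\<close> names the entry at position \<open>i\<close> of
    \<open>\<gamma> n\<close>; its images in later members name the same point of the limit.\<close>
  define D where "D = {p. snd p < length (\<gamma> (fst p))}"
  define val where "val N p = \<gamma> N ! pos e N p" for N p
  have pos_bound: "pos e N p < length (\<gamma> N)" if "p \<in> D" "fst p \<le> N" for p N
    using that(2)
  proof (induction N rule: dec_induct)
    case base
    then show ?case using that(1) by (simp add: pos_fst D_def)
  next
    case (step N)
    then show ?case using e(2) by simp
  qed
  \<comment> \<open>Once both entries are present, \<open>pos\<close> advances by
    \<open>e N\<close>, which preserves both orders.\<close>
  have pos_Suc: "pos e (Suc N) p < pos e (Suc N) q \<longleftrightarrow> pos e N p < pos e N q"
    and val_Suc: "val (Suc N) p < val (Suc N) q \<longleftrightarrow> val N p < val N q"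
    if "p \<in> D" "q \<in> D" "fst p \<le> N" "fst q \<le> N" for p q N
    using that pos_bound by (auto simp: val_def e_less e(3))
  \<comment> \<open>Index of the earliest member containing both entries: the fixed place of
    comparison, whose verdict every later member repeats.\<close>
  define M where "M p q = max (fst p) (fst q)" for p q :: "nat \<times> nat"
  have pos_stable: "pos e N p < pos e N q \<longleftrightarrow> pos e (M p q) p < pos e (M p q) q"
    and val_stable: "val N p < val N q \<longleftrightarrow> val (M p q) p < val (M p q) q"
    if "p \<in> D" "q \<in> D" "fst p \<le> N" "fst q \<le> N" for p q N
  proof -
    have "M p q \<le> N" using that by (simp add: M_def)
    then have "(pos e N p < pos e N q \<longleftrightarrow> pos e (M p q) p < pos e (M p q) q) \<and>
      (val N p < val N q \<longleftrightarrow> val (M p q) p < val (M p q) q)"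
    proof (induction N rule: dec_induct)
      case (step N)
      then have "fst p \<le> N" "fst q \<le> N" by (auto simp: M_def)
      then show ?case using step.IH pos_Suc val_Suc that(1,2) by blast
    qed simp
    then show "pos e N p < pos e N q \<longleftrightarrow> pos e (M p q) p < pos e (M p q) q"
      "val N p < val N q \<longleftrightarrow> val (M p q) p < val (M p q) q" by blast+
  qed
  have M_commute: "M p q = M q p" for p q by (simp add: M_def max.commute)
  have common: "\<exists>N. fst p \<le> N \<and> fst q \<le> N \<and> fst r \<le> N" for p q r :: "nat \<times> nat"
    by (meson max.cobounded1 max.cobounded2 order_trans)
  \<comment> \<open>Here and for \<open>g\<close>, the preorder is the negated reverse strict order,
    as stability is proved for \<open><\<close>; transitivity is checked in a member containing all
    three entries.\<close>
  obtain f :: "nat \<times> nat \<Rightarrow> real"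
    where f: "\<And>p q. p \<in> D \<Longrightarrow> q \<in> D \<Longrightarrow> f p \<le> f q \<longleftrightarrow> \<not> pos e (M p q) q < pos e (M p q) p"
  proof (rule countable_linear_preorder_real_embedding)
    fix p q assume "p \<in> D" "q \<in> D"
    show "\<not> pos e (M p q) q < pos e (M p q) p \<or> \<not> pos e (M q p) p < pos e (M q p) q"
      by (metis M_commute less_asym)
  next
    fix p q r assume D: "p \<in> D" "q \<in> D" "r \<in> D"
      and 1: "\<not> pos e (M p q) q < pos e (M p q) p" and 2: "\<not> pos e (M q r) r < pos e (M q r) q"
    obtain N where N: "fst p \<le> N" "fst q \<le> N" "fst r \<le> N" using common by blast
    have "pos e N p \<le> pos e N q" "pos e N q \<le> pos e N r"
      using 1 2 pos_stable[of q p N] pos_stable[of r q N] D N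
      by (simp_all add: M_commute[of q p] M_commute[of r q] not_less)
    then have "\<not> pos e N r < pos e N p" by (simp add: not_less)
    then show "\<not> pos e (M p r) r < pos e (M p r) p"
      using pos_stable[of r p N] D N by (simp add: M_commute[of r p])
  qed blast
  obtain g :: "nat \<times> nat \<Rightarrow> real"
    where g: "\<And>p q. p \<in> D \<Longrightarrow> q \<in> D \<Longrightarrow> g p \<le> g q \<longleftrightarrow> \<not> val (M p q) q < val (M p q) p"
  proof (rule countable_linear_preorder_real_embedding)
    fix p q assume "p \<in> D" "q \<in> D"
    show "\<not> val (M p q) q < val (M p q) p \<or> \<not> val (M q p) p < val (M q p) q"
      by (metis M_commute less_asym)
  next
    fix p q r assume D: "p \<in> D" "q \<in> D" "r \<in> D"
      and 1: "\<not> val (M p q) q < val (M p q) p" and 2: "\<not> val (M q r) r < val (M q r) q"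
    obtain N where N: "fst p \<le> N" "fst q \<le> N" "fst r \<le> N" using common by blast
    have "val N p \<le> val N q" "val N q \<le> val N r"
      using 1 2 val_stable[of q p N] val_stable[of r q N] D N
      by (simp_all add: M_commute[of q p] M_commute[of r q] flip: not_less)
    then have "\<not> val N r < val N p" by (simp add: not_less)
    then show "\<not> val (M p r) r < val (M p r) p"
      using val_stable[of r p N] D N by (simp add: M_commute[of r p])
  qed blast
  have f_less: "f p < f q \<longleftrightarrow> pos e N p < pos e N q"
    and g_less: "g p < g q \<longleftrightarrow> val N p < val N q"
    if "p \<in> D" "q \<in> D" "fst p \<le> N" "fst q \<le> N" for p q N
    using f[of q p] g[of q p] pos_stable[of p q N] val_stable[of p q N] that
    by (auto simp: M_commute[of q p] simp flip: not_le)
  \<comment> \<open>In a member containing both entries, distinctness makes equal positions the same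
    as equal values. This is what makes \<pi> well defined and injective.\<close>
  have f_eq_iff: "f p = f q \<longleftrightarrow> g p = g q" if "p \<in> D" "q \<in> D" for p q
  proof -
    obtain N where N: "fst p \<le> N" "fst q \<le> N" using common by blast
    have "f p = f q \<longleftrightarrow> pos e N p = pos e N q"
      using f_less[of p q N] f_less[of q p N] that N by (metis less_irrefl linorder_neqE)
    also have "\<dots> \<longleftrightarrow> val N p = val N q"
      using dist pos_bound that N by (simp add: val_def nth_eq_iff_index_eq)
    also have "\<dots> \<longleftrightarrow> g p = g q"
      using g_less[of p q N] g_less[of q p N] that N by (metis less_irrefl linorder_neqE)
    finally show ?thesis .
  qed
  \<comment> \<open>A real position is lifted to some entry lying there; \<open>f_eq_iff\<close>
    makes the value independent of the choice.\<close>
  define \<pi> where "\<pi> x = g (SOME p. p \<in> D \<and> f p = x)" for x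
  have \<pi>: "\<pi> (f p) = g p" if "p \<in> D" for p
  proof -
    have "(SOME q. q \<in> D \<and> f q = f p) \<in> D \<and> f (SOME q. q \<in> D \<and> f q = f p) = f p"
      by (rule someI[of _ p]) (use that in simp)
    then show ?thesis unfolding \<pi>_def using f_eq_iff that by blast
  qed
  have "inj_on \<pi> (f ` D)" by (auto simp: inj_on_def \<pi> f_eq_iff)
  moreover have "\<alpha> \<in> Sub \<pi> (f ` D) \<longleftrightarrow> \<alpha> \<in> permutations \<and> (\<exists>n. \<alpha> \<preceq> \<gamma> n)" for \<alpha>
  proof (intro iffI conjI; (elim conjE exE)?)
    assume \<alpha>: "\<alpha> \<in> Sub \<pi> (f ` D)"
    then show "\<alpha> \<in> permutations" by (simp add: Sub_def)
    obtain c where c: "strict_mono_on {..<length \<alpha>} c" "\<forall>i<length \<alpha>. c i \<in> f ` D"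
      "\<forall>i<length \<alpha>. \<forall>j<length \<alpha>. \<alpha> ! i < \<alpha> ! j \<longleftrightarrow> \<pi> (c i) < \<pi> (c j)"
      using \<alpha> unfolding mem_Sub_iff_index_map by blast
    define p where "p i = inv_into D f (c i)" for i
    have p: "p i \<in> D \<and> c i = f (p i)" if "i < length \<alpha>" for i
      using c(2) that by (simp add: p_def inv_into_into f_inv_into_f)
    \<comment> \<open>Finitely many entries all occur in one member. For empty \<alpha> this
      \<open>Max\<close> is unspecified, but then nothing has to be embedded.\<close>
    define N where "N = Max ((fst \<circ> p) ` {..<length \<alpha>})"
    have N: "fst (p i) \<le> N" if "i < length \<alpha>" for i
      unfolding N_def using that by (intro Max_ge) auto
    have "strict_mono_on {..<length \<alpha>} (\<lambda>i. pos e N (p i))"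
      using c(1) p N f_less[of _ _ N] by (simp add: strict_mono_on_def)
    moreover have "\<alpha> ! i < \<alpha> ! j \<longleftrightarrow> \<gamma> N ! pos e N (p i) < \<gamma> N ! pos e N (p j)"
      if "i < length \<alpha>" "j < length \<alpha>" for i j
      using c(3) p[of i] p[of j] N[of i] N[of j] g_less[of "p i" "p j" N] that
      by (simp add: \<pi> val_def)
    ultimately have "\<alpha> \<preceq> \<gamma> N"
      unfolding involved_iff_index_map using p N pos_bound by blast
    then show "\<exists>n. \<alpha> \<preceq> \<gamma> n" ..
  next
    fix n assume "\<alpha> \<in> permutations" "\<alpha> \<preceq> \<gamma> n"
    then obtain h where h: "strict_mono_on {..<length \<alpha>} h" "\<forall>i<length \<alpha>. h i < length (\<gamma> n)"
      "\<forall>i<length \<alpha>. \<forall>j<length \<alpha>. \<alpha> ! i < \<alpha> ! j \<longleftrightarrow> \<gamma> n ! h i < \<gamma> n ! h j"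
      unfolding involved_iff_index_map by blast
    \<comment> \<open>The entries of \<open>\<gamma> n\<close> used by \<alpha> are named with first
      component \<open>n\<close>, so that \<open>pos\<close> at \<open>n\<close> returns the given
      position.\<close>
    have D: "(n, h i) \<in> D" if "i < length \<alpha>" for i using h(2) that by (simp add: D_def)
    have pos: "pos e n (n, i) = i" for i using pos_fst[of e "(n, i)"] by simp
    have "strict_mono_on {..<length \<alpha>} (\<lambda>i. f (n, h i))"
      using h(1) D f_less[of _ _ n] by (simp add: strict_mono_on_def pos)
    moreover have "\<alpha> ! i < \<alpha> ! j \<longleftrightarrow> \<pi> (f (n, h i)) < \<pi> (f (n, h j))"
      if "i < length \<alpha>" "j < length \<alpha>" for i j
      using h(3) D g_less[of "(n, h i)" "(n, h j)" n] that by (simp add: \<pi> pos val_def)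
    ultimately show "\<alpha> \<in> Sub \<pi> (f ` D)"
      unfolding mem_Sub_iff_index_map using \<open>\<alpha> \<in> permutations\<close> D
      by (intro conjI exI[of _ "\<lambda>i. f (n, h i)"]) auto
  qed
  ultimately show thesis by (intro that[of \<pi> "f ` D"]) auto
qed

section \<open>The equivalences\<close>

text \<open>Along an enumeration of \<open>X\<close>, each new term bounds the previous term and the
  next enumerated element, so every element is bounded at some stage.\<close>

lemma directed_countable_imp_cofinal_chain:
  fixes R :: "'a \<Rightarrow> 'a \<Rightarrow> bool"
  assumes "countable X" "X \<noteq> {}" and directed: "\<forall>x\<in>X. \<forall>y\<in>X. \<exists>z\<in>X. R x z \<and> R y z"
  shows "\<exists>\<gamma> :: nat \<Rightarrow> 'a. (\<forall>n. \<gamma> n \<in> X) \<and> (\<forall>n. R (\<gamma> n) (\<gamma> (Suc n))) \<and> (\<forall>x\<in>X. \<exists>n. R x (\<gamma> n))"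
proof -
  obtain j where j: "\<And>x y. x \<in> X \<Longrightarrow> y \<in> X \<Longrightarrow> j x y \<in> X \<and> R x (j x y) \<and> R y (j x y)"
    using directed by metis
  define \<gamma> where "\<gamma> = rec_nat (from_nat_into X 0) (\<lambda>n x. j x (from_nat_into X n))"
  have Suc: "\<gamma> (Suc n) = j (\<gamma> n) (from_nat_into X n)" for n by (simp add: \<gamma>_def)
  have X: "from_nat_into X n \<in> X" for n using \<open>X \<noteq> {}\<close> by (rule from_nat_into)
  have \<gamma>: "\<gamma> n \<in> X" for n
    by (induction n) (use X j in \<open>simp_all add: \<gamma>_def\<close>)
  have "\<exists>n. R x (\<gamma> n)" if "x \<in> X" for x
    using from_nat_into_surj[OF assms(1) that] Suc j \<gamma> X by metis
  then show ?thesis using \<gamma> Suc j X by metis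
qed

text \<open>Supplies the two pieces of the decomposition when \<alpha> and \<beta> have no common
  bound; by transitivity, avoidance passes downwards.\<close>

lemma closed_class_not_above:
  assumes "closed_class X"
  shows "closed_class {\<gamma> \<in> X. \<not> \<alpha> \<preceq> \<gamma>}"
  unfolding closed_class_def
proof (intro conjI ballI impI)
  show "{\<gamma> \<in> X. \<not> \<alpha> \<preceq> \<gamma>} \<subseteq> permutations"
    using assms by (auto simp: closed_class_def)
  fix \<gamma> \<delta> assume "\<gamma> \<in> {\<gamma> \<in> X. \<not> \<alpha> \<preceq> \<gamma>}" "\<delta> \<in> permutations" "\<delta> \<preceq> \<gamma>"
  then show "\<delta> \<in> {\<gamma> \<in> X. \<not> \<alpha> \<preceq> \<gamma>}"
    using assms involved_trans[of \<alpha> \<delta> \<gamma>] unfolding closed_class_def by blast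
qed

text \<open>Nonemptiness matters: the empty class satisfies \<open>c2\<close> and \<open>c3\<close>,
  whereas every \<open>Sub\<close> contains the empty permutation and a chain needs members.\<close>

theorem theorem1:
  fixes X :: "nat list set"
  defines "c1 \<equiv> (\<exists>(A :: real set) (B :: real set) \<pi>. bij_betw \<pi> A B \<and> X = Sub \<pi> A)"
    and "c2 \<equiv> \<not> (\<exists>Y Z. closed_class Y \<and> closed_class Z \<and> Y \<subset> X \<and> Z \<subset> X \<and> X = Y \<union> Z)"
    and "c3 \<equiv> (\<forall>\<alpha>\<in>X. \<forall>\<beta>\<in>X. \<exists>\<gamma>\<in>X. \<alpha> \<preceq> \<gamma> \<and> \<beta> \<preceq> \<gamma>)"
    and "c4 \<equiv> (\<exists>\<gamma> :: nat \<Rightarrow> nat list. (\<forall>n. \<gamma> n \<in> X) \<and> (\<forall>n. \<gamma> n \<preceq> \<gamma> (Suc n)) \<and>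
                 (\<forall>\<alpha>\<in>X. \<exists>n. \<alpha> \<preceq> \<gamma> n))"
  assumes "closed_class X" and "X \<noteq> {}"
  shows "(c1 \<longleftrightarrow> c2) \<and> (c2 \<longleftrightarrow> c3) \<and> (c3 \<longleftrightarrow> c4)"
proof -
  have X: "X \<subseteq> permutations"
    and down: "\<And>\<alpha> \<delta>. \<alpha> \<in> X \<Longrightarrow> \<delta> \<in> permutations \<Longrightarrow> \<delta> \<preceq> \<alpha> \<Longrightarrow> \<delta> \<in> X"
    using \<open>closed_class X\<close> unfolding closed_class_def by blast+
  have "c1 \<Longrightarrow> c3"
    unfolding c1_def c3_def using Sub_joint_embedding bij_betw_imp_inj_on by metis
  moreover have "c3 \<Longrightarrow> c2"
  proof -
    assume c3
    show c2 unfolding c2_def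
    proof (intro notI, elim exE conjE)
      fix Y Z assume YZ: "closed_class Y" "closed_class Z" "Y \<subset> X" "Z \<subset> X" "X = Y \<union> Z"
      \<comment> \<open>Each part is proper, so it misses some element; a bound of the two missed
        elements lies in neither part, since both are closed downwards.\<close>
      then obtain \<alpha> \<beta> where ab: "\<alpha> \<in> X" "\<alpha> \<notin> Y" "\<beta> \<in> X" "\<beta> \<notin> Z" by blast
      then obtain \<gamma> where \<gamma>: "\<gamma> \<in> X" "\<alpha> \<preceq> \<gamma>" "\<beta> \<preceq> \<gamma>"
        using \<open>c3\<close> unfolding c3_def by blast
      have perm: "\<alpha> \<in> permutations" "\<beta> \<in> permutations" using ab X by blast+
      have "\<gamma> \<notin> Y" using YZ(1) ab(2) \<gamma>(2) perm(1) unfolding closed_class_def by blast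
      moreover have "\<gamma> \<notin> Z" using YZ(2) ab(4) \<gamma>(3) perm(2) unfolding closed_class_def by blast
      ultimately show False using \<gamma>(1) YZ(5) by blast
    qed
  qed
  moreover have "c2 \<Longrightarrow> c3"
  proof (rule ccontr)
    assume c2 "\<not> c3"
    then obtain \<alpha> \<beta> where ab: "\<alpha> \<in> X" "\<beta> \<in> X" "\<not> (\<exists>\<gamma>\<in>X. \<alpha> \<preceq> \<gamma> \<and> \<beta> \<preceq> \<gamma>)"
      unfolding c3_def by blast
    let ?Y = "{\<gamma> \<in> X. \<not> \<alpha> \<preceq> \<gamma>}" and ?Z = "{\<gamma> \<in> X. \<not> \<beta> \<preceq> \<gamma>}"
    \<comment> \<open>Reflexivity of involvement makes both pieces proper.\<close>
    have "\<alpha> \<notin> ?Y" "\<beta> \<notin> ?Z" by (simp_all add: involved_refl)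
    then have "?Y \<subset> X" "?Z \<subset> X" using ab(1,2) by auto
    moreover have "X = ?Y \<union> ?Z" using ab(3) by auto
    moreover have "closed_class ?Y" "closed_class ?Z"
      using \<open>closed_class X\<close> by (simp_all only: closed_class_not_above)
    ultimately have "\<exists>Y Z. closed_class Y \<and> closed_class Z \<and> Y \<subset> X \<and> Z \<subset> X \<and> X = Y \<union> Z"
      by (intro exI[of _ ?Y] exI[of _ ?Z] conjI)
    then show False using \<open>c2\<close> unfolding c2_def by contradiction
  qed
  \<comment> \<open>Lists of naturals form a countable type, so \<open>X\<close> is
    countable.\<close>
  moreover have "c3 \<Longrightarrow> c4"
    unfolding c3_def c4_def
    by (rule directed_countable_imp_cofinal_chain) (use \<open>X \<noteq> {}\<close> in simp_all)
  moreover have "c4 \<Longrightarrow> c1"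
  proof -
    assume c4
    then obtain \<gamma> where \<gamma>: "\<And>n. \<gamma> n \<in> X" "\<And>n. \<gamma> n \<preceq> \<gamma> (Suc n)" "\<And>\<alpha>. \<alpha> \<in> X \<Longrightarrow> \<exists>n. \<alpha> \<preceq> \<gamma> n"
      unfolding c4_def by blast
    have "distinct (\<gamma> n)" for n using \<gamma>(1)[of n] X by (auto simp: permutations_def)
    then obtain A \<pi> where A: "inj_on \<pi> A" "Sub \<pi> A = {\<alpha> \<in> permutations. \<exists>n. \<alpha> \<preceq> \<gamma> n}"
      by (rule chain_limit[of \<gamma>, OF \<gamma>(2)])
    \<comment> \<open>Members of \<open>X\<close> lie below the chain by cofinality; conversely the
      chain lies in \<open>X\<close>, which is closed downwards.\<close>
    have "X = Sub \<pi> A" unfolding A(2) using X down \<gamma> by blast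
    then show c1 unfolding c1_def using inj_on_imp_bij_betw[OF A(1)] by blast
  qed
  ultimately show ?thesis by blast
qed

end
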